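(* Let $\mathsf{P}$ be a finite-dimensional register and $\mathsf{R}$ a one-qubit register, let $U_1,U_2$ be unitaries on $\mathsf{P}\mathsf{R}$, and let $O'_1,O'_2$ be Hermitian operators on $\mathsf{P}\mathsf{R}$ with $(O'_1)^2=(O'_2)^2=I$. Write $Z=I_{\mathsf{P}}\otimes Z_{\mathsf{R}}$ and $|00\rangle=|0\rangle_{\mathsf{P}}|0\rangle_{\mathsf{R}}$. For $F=(F_1,F_2)\in\{0,1\}^2$ put $U_{1,F}=Z^{F_1}U_1$, $U_{2,F}=Z^{F_2}U_2Z^{F_1}U_1$, and put $U_{1\to2}=U_2$, $U_{2\to2}=I$. For $u\in\{1,2\}$ define $$p_{\mathrm{cons}}(u,F)=\sum_{a\in\{\pm1\}}\Big\|\tfrac{I+aO'_u}{2}\,U_{u\to2}\,\tfrac{I+aZ}{2}\,U_{u,F}|00\rangle\Big\|^2,\qquad p_{\mathrm{anti}}=\sum_{a\in\{\pm1\}}\Big\|\tfrac{I-aO'_1}{2}\,Z\,U_2\,\tfrac{I+aZ}{2}\,U_1|00\rangle\Big\|^2,$$ and the acceptance probability $$p_{\mathrm{acc}}=\tfrac12\Big(\tfrac12p_{\mathrm{cons}}(1,(0,0))+\tfrac14p_{\mathrm{cons}}(2,(0,0))+\tfrac14p_{\mathrm{cons}}(2,(1,0))\Big)+\tfrac12p_{\mathrm{anti}}.$$ (1) Completeness: if $\mathsf{P}$ is one qubit, $R_1=|0\rangle\langle0|_{\mathsf{P}}\otimes I_{\mathsf{R}}+|1\rangle\langle1|_{\mathsf{P}}\otimes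 X_{\mathsf{R}}$, $R_2=|+\rangle\langle+|_{\mathsf{P}}\otimes I_{\mathsf{R}}+|-\rangle\langle-|_{\mathsf{P}}\otimes X_{\mathsf{R}}$, and $U_1=R_1$, $U_2=R_2R_1^{-1}$, $O'_1=R_2Z_{\mathsf{P}}R_2^{-1}$, $O'_2=R_2X_{\mathsf{P}}R_2^{-1}$, then $p_{\mathrm{acc}}=1$. (2) Soundness: there is an absolute constant $C$ such that for every $\delta>0$ and every such $\mathsf{P},U_1,U_2,O'_1,O'_2$, if $p_{\mathrm{acc}}>1-\delta$ then, with $\rho=U_2U_1|00\rangle\langle00|U_1^\dagger U_2^\dagger$, $$\mathrm{Tr}\big((O'_1O'_2+O'_2O'_1)^2\rho\big)\le C\delta.$$
   Context: This describes a three-round single-qubit test: in rounds 1 and 2 a prover applies $U_1$, resp. $U_2$, to its registers and sends $\mathsf{R}$; the verifier optionally applies $Z_{\mathsf{R}}$ and/or measures $Z_{\mathsf{R}}$, then returns $\mathsf{R}$; in round 3 the verifier sends $q'\in\{1,2\}$ and the prover returns the outcome of measuring $O'_{q'}$. With probability $1/2$ a consistency check is run (measure in round $u$ uniform in $\{1,2\}$; if $u=2$ optionally flip with $Z$ in round 1; accept iff the round-$u$ outcome equals the answer to $q'=u$), and with probability $1/2$ an anti-commuting test (measure in round 1, apply $Z$ in round 2, ask $q'=1$, accept iff outcomes are opposite); $p_{\mathrm{acc}}$ is the resulting acceptance probability. Measurement outcomes are $\pm1$-valued. *)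

theory Defs
  imports
    Complex_Main
    "HOL-Library.Complex_Order"
    "Jordan_Normal_Form.Gauss_Jordan_Elimination"
    "Jordan_Normal_Form.Schur_Decomposition"
begin

text \<open>
  Registers are represented by their dimension, operators by complex matrices and states by
  complex vectors. The register \<open>P\<close> has an arbitrary dimension \<open>n > 0\<close>, and \<open>R\<close> has dimension 2.
  The joint register \<open>PR\<close> has dimension \<open>n * 2\<close>; the basis state \<open>|p\<rangle>|r\<rangle>\<close> has index \<open>p * 2 + r\<close>.
\<close>

definition tensor_mat :: "complex mat \<Rightarrow> complex mat \<Rightarrow> complex mat" where
  "tensor_mat A B = mat (dim_row A * dim_row B) (dim_col A * dim_col B)
     (\<lambda>(i, j). A $$ (i div dim_row B, j div dim_col B) * B $$ (i mod dim_row B, j mod dim_col B))"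

definition tensor_vec :: "complex vec \<Rightarrow> complex vec \<Rightarrow> complex vec" where
  "tensor_vec v w = vec (dim_vec v * dim_vec w) (\<lambda>i. v $ (i div dim_vec w) * w $ (i mod dim_vec w))"

definition ket_bra :: "complex vec \<Rightarrow> complex vec \<Rightarrow> complex mat" where
  "ket_bra v w = mat (dim_vec v) (dim_vec w) (\<lambda>(i, j). v $ i * cnj (w $ j))"

definition l2_norm :: "complex vec \<Rightarrow> real" where
  "l2_norm v = sqrt (\<Sum>i<dim_vec v. (cmod (v $ i))\<^sup>2)"

definition trace :: "complex mat \<Rightarrow> complex" where
  "trace A = (\<Sum>i<dim_row A. A $$ (i, i))"

definition unitary_on :: "nat \<Rightarrow> complex mat \<Rightarrow> bool" where
  "unitary_on d U \<longleftrightarrow> U \<in> carrier_mat d d \<and> mat_adjoint U * U = 1\<^sub>m d \<and> U * mat_adjoint U = 1\<^sub>m d"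

definition hermitian_on :: "nat \<Rightarrow> complex mat \<Rightarrow> bool" where
  "hermitian_on d A \<longleftrightarrow> A \<in> carrier_mat d d \<and> mat_adjoint A = A"

text \<open>\<^const>\<open>mat_inverse\<close> returns \<^term>\<open>None\<close> on singular matrices; it is applied below only to
  invertible ones.\<close>

definition inv_mat :: "complex mat \<Rightarrow> complex mat" where
  "inv_mat A = the (mat_inverse A)"

definition pauli_X :: "complex mat" where
  "pauli_X = mat_of_rows_list 2 [[0, 1], [1, 0]]"

definition pauli_Z :: "complex mat" where
  "pauli_Z = mat_of_rows_list 2 [[1, 0], [0, -1]]"

definition ket0 :: "complex vec" where "ket0 = unit_vec 2 0"
definition ket1 :: "complex vec" where "ket1 = unit_vec 2 1"
definition ket_plus :: "complex vec" where
  "ket_plus = complex_of_real (1 / sqrt 2) \<cdot>\<^sub>v (ket0 + ket1)"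
definition ket_minus :: "complex vec" where
  "ket_minus = complex_of_real (1 / sqrt 2) \<cdot>\<^sub>v (ket0 - ket1)"

definition strategy ::
    "nat \<Rightarrow> complex mat \<Rightarrow> complex mat \<Rightarrow> complex mat \<Rightarrow> complex mat \<Rightarrow> bool" where
  "strategy n U1 U2 O1 O2 \<longleftrightarrow>
     unitary_on (n * 2) U1 \<and> unitary_on (n * 2) U2 \<and>
     hermitian_on (n * 2) O1 \<and> hermitian_on (n * 2) O2 \<and>
     O1 * O1 = 1\<^sub>m (n * 2) \<and> O2 * O2 = 1\<^sub>m (n * 2)"

definition ZR :: "nat \<Rightarrow> complex mat" where
  "ZR n = tensor_mat (1\<^sub>m n) pauli_Z"

definition ket00 :: "nat \<Rightarrow> complex vec" where
  "ket00 n = tensor_vec (unit_vec n 0) ket0"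

definition outcome_proj :: "nat \<Rightarrow> complex \<Rightarrow> complex mat \<Rightarrow> complex mat" where
  "outcome_proj n a A = (1 / 2) \<cdot>\<^sub>m (1\<^sub>m (n * 2) + a \<cdot>\<^sub>m A)"

text \<open>In the next three functions the round \<open>u\<close> ranges over \<open>{1, 2}\<close> and the flip pattern \<open>F\<close>
  over \<open>{0, 1}\<^sup>2\<close>.\<close>

definition U_upto ::
    "nat \<Rightarrow> complex mat \<Rightarrow> complex mat \<Rightarrow> nat \<Rightarrow> nat \<times> nat \<Rightarrow> complex mat" where
  "U_upto n U1 U2 u F =
     (if u = 1 then (ZR n ^\<^sub>m fst F) * U1
      else (ZR n ^\<^sub>m snd F) * U2 * (ZR n ^\<^sub>m fst F) * U1)"

definition U_from :: "nat \<Rightarrow> complex mat \<Rightarrow> nat \<Rightarrow> complex mat" where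
  "U_from n U2 u = (if u = 1 then U2 else 1\<^sub>m (n * 2))"

definition p_cons ::
    "nat \<Rightarrow> complex mat \<Rightarrow> complex mat \<Rightarrow> complex mat \<Rightarrow> complex mat \<Rightarrow> nat \<Rightarrow> nat \<times> nat \<Rightarrow> real" where
  "p_cons n U1 U2 O1 O2 u F =
     (\<Sum>a\<in>{1, -1}.
        (l2_norm ((outcome_proj n a (if u = 1 then O1 else O2) * U_from n U2 u
                   * outcome_proj n a (ZR n) * U_upto n U1 U2 u F) *\<^sub>v ket00 n))\<^sup>2)"

definition p_anti ::
    "nat \<Rightarrow> complex mat \<Rightarrow> complex mat \<Rightarrow> complex mat \<Rightarrow> real" where
  "p_anti n U1 U2 O1 =
     (\<Sum>a\<in>{1, -1}.
        (l2_norm ((outcome_proj n (-a) O1 * ZR n * U2 * outcome_proj n a (ZR n) * U1)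
                  *\<^sub>v ket00 n))\<^sup>2)"

definition p_acc ::
    "nat \<Rightarrow> complex mat \<Rightarrow> complex mat \<Rightarrow> complex mat \<Rightarrow> complex mat \<Rightarrow> real" where
  "p_acc n U1 U2 O1 O2 =
     1/2 * (1/2 * p_cons n U1 U2 O1 O2 1 (0, 0)
          + 1/4 * p_cons n U1 U2 O1 O2 2 (0, 0)
          + 1/4 * p_cons n U1 U2 O1 O2 2 (1, 0))
     + 1/2 * p_anti n U1 U2 O1"

definition rho :: "nat \<Rightarrow> complex mat \<Rightarrow> complex mat \<Rightarrow> complex mat" where
  "rho n U1 U2 = U2 * U1 * ket_bra (ket00 n) (ket00 n) * mat_adjoint U1 * mat_adjoint U2"

definition R1 :: "complex mat" where
  "R1 = tensor_mat (ket_bra ket0 ket0) (1\<^sub>m 2) + tensor_mat (ket_bra ket1 ket1) pauli_X"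

definition R2 :: "complex mat" where
  "R2 = tensor_mat (ket_bra ket_plus ket_plus) (1\<^sub>m 2)
      + tensor_mat (ket_bra ket_minus ket_minus) pauli_X"

end

theory Submission
  imports Defs
begin

text \<open>
  Put \<open>\<phi> = U1 |00>\<close>. If \<open>P\<close> is a Hermitian involution and \<open>V\<close>, \<open>Q\<close> are unitary, then inserting
  \<open>(I + aQ)/2\<close> before \<open>V\<close> and \<open>(I + aP)/2\<close> after it and summing over \<open>a\<close> gives exactly
  \<open>\<parallel>\<phi>\<parallel>\<^sup>2 - \<parallel>(P V - V Q) \<phi>\<parallel>\<^sup>2 / 4\<close>, by the parallelogram law. So \<open>1 - p_acc\<close> is a positive
  combination of the squared norms of four defects:
  \<open>(O1 U2 - U2 Z) \<phi>\<close>, \<open>(O2 - Z) U2 \<phi>\<close>, \<open>(O2 - Z) U2 Z \<phi>\<close> and \<open>(O1 Z U2 + Z U2 Z) \<phi>\<close>.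
  The vector \<open>(O1 O2 + O2 O1) U2 \<phi>\<close> is a sum of unitary images of these four, each used once, which
  gives soundness with \<open>C = 128\<close>. For the honest strategy all four defects vanish.
\<close>

subsection \<open>Norms, adjoints and unitaries\<close>

lemma l2_norm_square: "(l2_norm v)\<^sup>2 = (\<Sum>i<dim_vec v. (cmod (v $ i))\<^sup>2)"
  unfolding l2_norm_def by (simp add: sum_nonneg)

lemma conjugate_square_eq_l2_norm: "v \<bullet>c v = complex_of_real ((l2_norm v)\<^sup>2)"
  unfolding l2_norm_square scalar_prod_def
  by (auto simp: lessThan_atLeast0 complex_norm_square simp del: of_real_power intro!: sum.cong)

text \<open>The identity holds for each pair of complex coordinates and is summed. It serves twice:
  as an exact formula for the acceptance probability and, with one term dropped, as a bound on sums
  of vectors.\<close>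

lemma parallelogram_l2_norm:
  assumes "x \<in> carrier_vec d" "y \<in> carrier_vec d"
  shows "(l2_norm (x + y))\<^sup>2 + (l2_norm (x - y))\<^sup>2 = 2 * (l2_norm x)\<^sup>2 + 2 * (l2_norm y)\<^sup>2"
proof -
  have "(cmod (a + b))\<^sup>2 + (cmod (a - b))\<^sup>2 = 2 * (cmod a)\<^sup>2 + 2 * (cmod b)\<^sup>2" for a b
    unfolding cmod_power2 by (simp add: power2_eq_square algebra_simps)
  then have "(\<Sum>i<d. (cmod (x $ i + y $ i))\<^sup>2 + (cmod (x $ i - y $ i))\<^sup>2)
      = (\<Sum>i<d. 2 * (cmod (x $ i))\<^sup>2 + 2 * (cmod (y $ i))\<^sup>2)"
    by (intro sum.cong) auto
  then show ?thesis
    using assms unfolding l2_norm_square by (simp add: sum.distrib sum_distrib_left)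
qed

lemma l2_norm_smult: "l2_norm (c \<cdot>\<^sub>v v) = cmod c * l2_norm v"
  unfolding l2_norm_def
  by (simp add: norm_mult power_mult_distrib real_sqrt_mult flip: sum_distrib_left)

lemma l2_norm_add4_le:
  assumes "w \<in> carrier_vec d" "x \<in> carrier_vec d" "y \<in> carrier_vec d" "z \<in> carrier_vec d"
  shows "(l2_norm ((w + x) + (y + z)))\<^sup>2
    \<le> 4 * ((l2_norm w)\<^sup>2 + (l2_norm x)\<^sup>2 + (l2_norm y)\<^sup>2 + (l2_norm z)\<^sup>2)"
proof -
  \<comment> \<open>The parallelogram law without its nonnegative difference term. Two nested uses
    give the factor 4.\<close>
  have add_le: "(l2_norm (u + v))\<^sup>2 \<le> 2 * (l2_norm u)\<^sup>2 + 2 * (l2_norm v)\<^sup>2"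
    if "u \<in> carrier_vec d" "v \<in> carrier_vec d" for u v
    using parallelogram_l2_norm[OF that] zero_le_power2[of "l2_norm (u - v)"] by linarith
  show ?thesis
    using add_le[OF assms(1,2)] add_le[OF assms(3,4)]
      add_le[OF add_carrier_vec[OF assms(1,2)] add_carrier_vec[OF assms(3,4)]]
    by (smt (verit))
qed

section \<open>Adjoints, unitaries and Hermitian involutions\<close>

lemma dim_mat_adjoint [simp]:
  "dim_row (mat_adjoint A) = dim_col A" "dim_col (mat_adjoint A) = dim_row A"
  unfolding mat_adjoint_def by auto

lemma mat_adjoint_carrier [simp]:
  "A \<in> carrier_mat m n \<Longrightarrow> mat_adjoint A \<in> carrier_mat n m"
  by (intro carrier_matI) auto

lemma index_mat_adjoint:
  assumes "i < dim_col A" "j < dim_row A"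
  shows "mat_adjoint A $$ (i, j) = conjugate (A $$ (j, i))"
  using assms unfolding mat_adjoint_def mat_of_rows_def by simp

lemma mat_adjoint_mult:
  fixes A B :: "complex mat"
  assumes "A \<in> carrier_mat l m" "B \<in> carrier_mat m n"
  shows "mat_adjoint (A * B) = mat_adjoint B * mat_adjoint A"
  using assms
  by (intro eq_matI) (auto simp: index_mat_adjoint scalar_prod_def mult.commute intro!: sum.cong)

lemma mat_adjoint_add:
  fixes A B :: "complex mat"
  assumes "A \<in> carrier_mat m n" "B \<in> carrier_mat m n"
  shows "mat_adjoint (A + B) = mat_adjoint A + mat_adjoint B"
  using assms by (intro eq_matI) (auto simp: index_mat_adjoint)

text \<open>Exchanging the row sum with the column sum moves \<open>A\<close> across the inner
  product, where it reappears conjugated and transposed because \<open>\<bullet>c\<close> conjugates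
  its second argument.\<close>

lemma conjugate_scalar_prod_mat_adjoint:
  fixes A :: "complex mat"
  assumes "A \<in> carrier_mat m n" "v \<in> carrier_vec n" "w \<in> carrier_vec m"
  shows "(A *\<^sub>v v) \<bullet>c w = v \<bullet>c (mat_adjoint A *\<^sub>v w)"
proof -
  have "(A *\<^sub>v v) \<bullet>c w = (\<Sum>i<m. \<Sum>j<n. A $$ (i, j) * v $ j * cnj (w $ i))"
    using assms by (simp add: scalar_prod_def lessThan_atLeast0 sum_distrib_right)
  also have "\<dots> = (\<Sum>j<n. \<Sum>i<m. A $$ (i, j) * v $ j * cnj (w $ i))"
    by (rule sum.swap)
  also have "\<dots> = v \<bullet>c (mat_adjoint A *\<^sub>v w)"
    using assms
    by (auto simp: scalar_prod_def lessThan_atLeast0 sum_distrib_left index_mat_adjoint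
        sum_conjugate mult_ac intro!: sum.cong)
  finally show ?thesis .
qed

lemma unitary_onD:
  assumes "unitary_on d U"
  shows "U \<in> carrier_mat d d" "mat_adjoint U * U = 1\<^sub>m d" "U * mat_adjoint U = 1\<^sub>m d"
  using assms unfolding unitary_on_def by auto

lemma l2_norm_unitary:
  assumes "unitary_on d U" "v \<in> carrier_vec d"
  shows "l2_norm (U *\<^sub>v v) = l2_norm v"
proof -
  note U = unitary_onD[OF assms(1)]
  have "(U *\<^sub>v v) \<bullet>c (U *\<^sub>v v) = v \<bullet>c (mat_adjoint U *\<^sub>v (U *\<^sub>v v))"
    by (rule conjugate_scalar_prod_mat_adjoint) (use U assms in auto)
  also have "mat_adjoint U *\<^sub>v (U *\<^sub>v v) = (mat_adjoint U * U) *\<^sub>v v"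
    by (rule assoc_mult_mat_vec[symmetric]) (use U assms in auto)
  also have "mat_adjoint U * U *\<^sub>v v = v"
    using U assms by simp
  finally have "(l2_norm (U *\<^sub>v v))\<^sup>2 = (l2_norm v)\<^sup>2"
    unfolding conjugate_square_eq_l2_norm of_real_eq_iff .
  then show ?thesis
    unfolding l2_norm_def by (simp add: sum_nonneg)
qed

lemma unitary_on_mult:
  assumes "unitary_on d U" "unitary_on d V"
  shows "unitary_on d (U * V)"
proof -
  note U = unitary_onD[OF assms(1)] and V = unitary_onD[OF assms(2)]
  \<comment> \<open>Both products with the adjoint of \<open>U * V\<close> collapse from the inside
    out, by cancelling first the inner adjoint pair and then the outer one.\<close>
  have cancel: "mat_adjoint A * (A * B) = B" if "unitary_on d A" "B \<in> carrier_mat d d" for A B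
  proof -
    note A = unitary_onD[OF that(1)]
    have "mat_adjoint A * (A * B) = mat_adjoint A * A * B"
      by (rule assoc_mult_mat[symmetric]) (use A that in auto)
    then show ?thesis using A that by simp
  qed
  have cancel': "A * (mat_adjoint A * B) = B" if "unitary_on d A" "B \<in> carrier_mat d d" for A B
  proof -
    note A = unitary_onD[OF that(1)]
    have "A * (mat_adjoint A * B) = A * mat_adjoint A * B"
      by (rule assoc_mult_mat[symmetric]) (use A that in auto)
    then show ?thesis using A that by simp
  qed
  have "mat_adjoint V * mat_adjoint U * (U * V) = mat_adjoint V * (mat_adjoint U * (U * V))"
    by (rule assoc_mult_mat) (use U V in auto)
  moreover have "U * V * (mat_adjoint V * mat_adjoint U) = U * (V * (mat_adjoint V * mat_adjoint U))"
    by (rule assoc_mult_mat) (use U V in auto)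
  ultimately show ?thesis
    using U V assms mat_adjoint_mult[OF U(1) V(1)] cancel[OF assms(1) V(1)]
      cancel'[OF assms(2), of "mat_adjoint U"]
    unfolding unitary_on_def by (simp add: mult_carrier_mat[of _ d d])
qed

lemma unitary_on_hermitian_involution:
  assumes "hermitian_on d A" "A * A = 1\<^sub>m d"
  shows "unitary_on d A"
  using assms unfolding unitary_on_def hermitian_on_def by simp


lemma hermitian_onD:
  assumes "hermitian_on d A"
  shows "A \<in> carrier_mat d d" "mat_adjoint A = A"
  using assms unfolding hermitian_on_def by auto

text \<open>The anti-commuting test accepts opposite outcomes, so it is treated as a consistency
  test for the observable \<open>- O1\<close>.\<close>

lemma hermitian_on_uminus:
  assumes "hermitian_on d A"
  shows "hermitian_on d (- A)"
proof -
  note A = hermitian_onD[OF assms]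
  have "conjugate (A $$ (j, i)) = A $$ (i, j)" if "i < d" "j < d" for i j
    using A that index_mat_adjoint[of i A j] by simp
  then have "mat_adjoint (- A) = - A"
    using A(1) by (intro eq_matI) (auto simp: index_mat_adjoint)
  then show ?thesis
    using A(1) unfolding hermitian_on_def by simp
qed

subsection \<open>The acceptance probability\<close>

lemma outcome_proj_carrier [simp]:
  "A \<in> carrier_mat (n * 2) (n * 2) \<Longrightarrow> outcome_proj n a A \<in> carrier_mat (n * 2) (n * 2)"
  unfolding outcome_proj_def by simp

lemma smult_mat_mult_vec:
  fixes A :: "complex mat"
  assumes "A \<in> carrier_mat m n" "v \<in> carrier_vec n"
  shows "(c \<cdot>\<^sub>m A) *\<^sub>v v = c \<cdot>\<^sub>v (A *\<^sub>v v)"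
  using assms by (intro eq_vecI) (auto simp: row_smult)

lemma outcome_proj_mult_vec:
  assumes "A \<in> carrier_mat (n * 2) (n * 2)" "v \<in> carrier_vec (n * 2)"
  shows "outcome_proj n a A *\<^sub>v v = (1/2) \<cdot>\<^sub>v (v + a \<cdot>\<^sub>v (A *\<^sub>v v))"
  using assms unfolding outcome_proj_def
  by (simp add: smult_mat_mult_vec[of _ "n * 2" "n * 2"]
      add_mult_distrib_mat_vec[of _ "n * 2" "n * 2"] del: index_mult_mat_vec)

lemma outcome_proj_uminus: "outcome_proj n (- a) A = outcome_proj n a (- A)"
proof -
  have "(- a) \<cdot>\<^sub>m A = a \<cdot>\<^sub>m (- A)"
    by (intro eq_matI) auto
  then show ?thesis
    unfolding outcome_proj_def by simp
qed

text \<open>Lets a run of the test be followed as a state passing through one operator after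
  another.\<close>

lemma mult_4_mat_vec:
  fixes A :: "complex mat"
  assumes "A \<in> carrier_mat d d" "B \<in> carrier_mat d d" "C \<in> carrier_mat d d"
    "D \<in> carrier_mat d d" "v \<in> carrier_vec d"
  shows "(A * B * C * D) *\<^sub>v v = A *\<^sub>v (B *\<^sub>v (C *\<^sub>v (D *\<^sub>v v)))"
proof -
  have AB: "A * B \<in> carrier_mat d d" and ABC: "A * B * C \<in> carrier_mat d d"
    using assms by (auto intro!: mult_carrier_mat)
  have Dv: "D *\<^sub>v v \<in> carrier_vec d"
    using assms by (intro mult_mat_vec_carrier)
  have CDv: "C *\<^sub>v (D *\<^sub>v v) \<in> carrier_vec d"
    using assms Dv by (intro mult_mat_vec_carrier)
  show ?thesis
    unfolding assoc_mult_mat_vec[OF ABC assms(4,5)] assoc_mult_mat_vec[OF AB assms(3) Dv]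
      assoc_mult_mat_vec[OF assms(1,2) CDv] ..
qed

text \<open>One formula for all four runs: \<open>Q\<close> is measured first, \<open>V\<close> acts
  in between, \<open>P\<close> gives the final answer. The loss is a quarter of the squared distance
  between \<open>P V \<phi>\<close> and \<open>V Q \<phi>\<close>, so the run succeeds with full
  weight exactly when \<open>P\<close> after \<open>V\<close> acts on \<open>\<phi>\<close> as
  \<open>Q\<close> before \<open>V\<close>.\<close>

lemma sum_outcome_proj:
  assumes P: "hermitian_on (n * 2) P" "P * P = 1\<^sub>m (n * 2)"
    and V: "unitary_on (n * 2) V" and Q: "unitary_on (n * 2) Q"
    and W: "W \<in> carrier_mat (n * 2) (n * 2)" and \<kappa>: "\<kappa> \<in> carrier_vec (n * 2)"
  defines "\<phi> \<equiv> W *\<^sub>v \<kappa>"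
  shows "(\<Sum>a\<in>{1, -1}. (l2_norm ((outcome_proj n a P * V * outcome_proj n a Q * W) *\<^sub>v \<kappa>))\<^sup>2)
    = (l2_norm \<phi>)\<^sup>2 - (l2_norm (P *\<^sub>v (V *\<^sub>v \<phi>) - V *\<^sub>v (Q *\<^sub>v \<phi>)))\<^sup>2 / 4"
proof -
  define d where "d = n * 2"
  note P' = hermitian_onD[OF P(1), folded d_def] and V' = unitary_onD[OF V, folded d_def]
    and Q' = unitary_onD[OF Q, folded d_def]
  note P_unitary = unitary_on_hermitian_involution[OF P, folded d_def]
  note mult_c = mult_mat_vec_carrier[of _ d d]
  define w where "w = V *\<^sub>v \<phi>"
  define x where "x = V *\<^sub>v (Q *\<^sub>v \<phi>)"
  define y where "y = P *\<^sub>v w"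
  define z where "z = P *\<^sub>v x"
  have \<phi>: "\<phi> \<in> carrier_vec d"
    using W \<kappa> mult_c unfolding \<phi>_def d_def by blast
  have Q\<phi>: "Q *\<^sub>v \<phi> \<in> carrier_vec d"
    using Q' \<phi> mult_c by blast
  have w: "w \<in> carrier_vec d" and x: "x \<in> carrier_vec d"
    using V' \<phi> Q\<phi> mult_c unfolding w_def x_def by blast+
  have y: "y \<in> carrier_vec d" and z: "z \<in> carrier_vec d"
    using P' w x mult_c unfolding y_def z_def by blast+
  have norms: "l2_norm x = l2_norm \<phi>" "l2_norm y = l2_norm \<phi>"
    unfolding x_def y_def w_def
    using l2_norm_unitary[OF V[folded d_def] \<phi>] l2_norm_unitary[OF V[folded d_def] Q\<phi>]
      l2_norm_unitary[OF Q[folded d_def] \<phi>] l2_norm_unitary[OF P_unitary w] w_def by auto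
  \<comment> \<open>Expanding both projections gives four terms, grouped by the power of
    \<open>a\<close>: for \<open>a = 1\<close> and \<open>a = -1\<close> the even part
    \<open>w + z\<close> is the same and the odd part \<open>x + y\<close> changes sign.\<close>
  have branch: "(outcome_proj n a P * V * outcome_proj n a Q * W) *\<^sub>v \<kappa>
      = (1/4) \<cdot>\<^sub>v ((w + (a * a) \<cdot>\<^sub>v z) + a \<cdot>\<^sub>v (x + y))" for a
  proof -
    have "(outcome_proj n a P * V * outcome_proj n a Q * W) *\<^sub>v \<kappa>
        = outcome_proj n a P *\<^sub>v (V *\<^sub>v (outcome_proj n a Q *\<^sub>v \<phi>))"
      using P' V' Q' W \<kappa> unfolding \<phi>_def d_def by (intro mult_4_mat_vec) auto
    also have "outcome_proj n a Q *\<^sub>v \<phi> = (1/2) \<cdot>\<^sub>v (\<phi> + a \<cdot>\<^sub>v (Q *\<^sub>v \<phi>))"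
      using Q' \<phi> unfolding d_def by (intro outcome_proj_mult_vec)
    also have "V *\<^sub>v \<dots> = (1/2) \<cdot>\<^sub>v (w + a \<cdot>\<^sub>v x)"
      using V' \<phi> Q\<phi> unfolding w_def x_def
      by (simp add: mult_mat_vec[of _ d d] mult_add_distrib_mat_vec[of _ d d]
          del: index_mult_mat_vec)
    also have "outcome_proj n a P *\<^sub>v \<dots>
        = (1/2) \<cdot>\<^sub>v ((1/2) \<cdot>\<^sub>v (w + a \<cdot>\<^sub>v x) + a \<cdot>\<^sub>v (P *\<^sub>v ((1/2) \<cdot>\<^sub>v (w + a \<cdot>\<^sub>v x))))"
      using P' w x unfolding d_def by (intro outcome_proj_mult_vec) auto
    also have "P *\<^sub>v ((1/2) \<cdot>\<^sub>v (w + a \<cdot>\<^sub>v x)) = (1/2) \<cdot>\<^sub>v (y + a \<cdot>\<^sub>v z)"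
      using P' w x unfolding y_def z_def
      by (simp add: mult_mat_vec[of _ d d] mult_add_distrib_mat_vec[of _ d d]
          del: index_mult_mat_vec)
    also have "(1/2) \<cdot>\<^sub>v ((1/2) \<cdot>\<^sub>v (w + a \<cdot>\<^sub>v x) + a \<cdot>\<^sub>v ((1/2) \<cdot>\<^sub>v (y + a \<cdot>\<^sub>v z)))
        = (1/4) \<cdot>\<^sub>v ((w + (a * a) \<cdot>\<^sub>v z) + a \<cdot>\<^sub>v (x + y))"
      using w x y z by (intro eq_vecI) (auto simp: algebra_simps)
    finally show ?thesis .
  qed
  \<comment> \<open>Since \<open>P\<close> is an involution, it maps the even part
    \<open>w + z\<close> to the odd part \<open>x + y\<close>, and being unitary it makes their
    norms equal.\<close>
  have "P *\<^sub>v z = x"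
    using P' x P(2) assoc_mult_mat_vec[OF P'(1) P'(1) x] unfolding z_def d_def by simp
  then have "x + y = P *\<^sub>v (w + z)"
    using P' w z x y comm_add_vec[OF x y] unfolding y_def
    by (simp add: mult_add_distrib_mat_vec[of _ d d] del: index_mult_mat_vec)
  then have norm_wz: "l2_norm (w + z) = l2_norm (x + y)"
    using l2_norm_unitary[OF P_unitary add_carrier_vec[OF w z]] by simp
  \<comment> \<open>Without this the sum over the set \<open>{1, -1}\<close> could not be split into
    two terms.\<close>
  have "(1 :: complex) \<noteq> -1"
    by simp
  then have "(\<Sum>a\<in>{1, -1}. (l2_norm ((outcome_proj n a P * V * outcome_proj n a Q * W) *\<^sub>v \<kappa>))\<^sup>2)
      = (l2_norm ((1/4) \<cdot>\<^sub>v ((w + z) + (x + y))))\<^sup>2 + (l2_norm ((1/4) \<cdot>\<^sub>v ((w + z) + (-1) \<cdot>\<^sub>v (x + y))))\<^sup>2"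
    unfolding branch by simp
  also have "(w + z) + (-1) \<cdot>\<^sub>v (x + y) = (w + z) - (x + y)"
    using w x y z by (intro eq_vecI) auto
  also have "(l2_norm ((1/4) \<cdot>\<^sub>v ((w + z) + (x + y))))\<^sup>2 + (l2_norm ((1/4) \<cdot>\<^sub>v ((w + z) - (x + y))))\<^sup>2
      = (l2_norm (x + y))\<^sup>2 / 4"
    using parallelogram_l2_norm[OF add_carrier_vec[OF w z] add_carrier_vec[OF x y]]
    unfolding l2_norm_smult norm_wz by (simp add: power_mult_distrib power2_eq_square)
  \<comment> \<open>A second parallelogram, now for \<open>y\<close> and \<open>x\<close>, which
    both have the norm of \<open>\<phi>\<close>, trades the sum for the defect.\<close>
  also have "(l2_norm (x + y))\<^sup>2 = 4 * (l2_norm \<phi>)\<^sup>2 - (l2_norm (y - x))\<^sup>2"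
    using parallelogram_l2_norm[OF y x] comm_add_vec[OF x y] unfolding norms by simp
  finally show ?thesis
    unfolding y_def x_def w_def by simp
qed


section \<open>The operator \<open>ZR\<close> and the initial state\<close>

lemma dim_pauli_Z [simp]: "dim_row pauli_Z = 2" "dim_col pauli_Z = 2"
  unfolding pauli_Z_def mat_of_rows_list_def by simp_all

lemma index_pauli_Z: "i < 2 \<Longrightarrow> j < 2 \<Longrightarrow> pauli_Z $$ (i, j) = (if i = j then (-1) ^ i else 0)"
  unfolding pauli_Z_def mat_of_rows_list_def by (auto simp: less_2_cases_iff)

lemma ZR_carrier [simp]: "ZR n \<in> carrier_mat (n * 2) (n * 2)"
  unfolding ZR_def tensor_mat_def by simp

text \<open>The qubit \<open>R\<close> is the low-order digit of a basis index, so \<open>ZR\<close>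
  is diagonal with sign given by the parity of the index.\<close>

lemma index_ZR:
  assumes "i < n * 2" "j < n * 2"
  shows "ZR n $$ (i, j) = (if i = j then (-1) ^ (i mod 2) else 0)"
proof -
  have "i = j \<longleftrightarrow> i div 2 = j div 2 \<and> i mod 2 = j mod 2"
    by (metis div_mult_mod_eq)
  then show ?thesis
    using assms unfolding ZR_def tensor_mat_def
    by (simp add: less_mult_imp_div_less index_pauli_Z)
qed

lemma ZR_hermitian: "hermitian_on (n * 2) (ZR n)"
  unfolding hermitian_on_def
  by (auto simp: carrier_matD[OF ZR_carrier] index_ZR index_mat_adjoint intro!: eq_matI)

lemma ZR_involution: "ZR n * ZR n = 1\<^sub>m (n * 2)"
proof (rule eq_matI)
  fix i j assume "i < dim_row (1\<^sub>m (n * 2) :: complex mat)" "j < dim_col (1\<^sub>m (n * 2) :: complex mat)"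
  then have ij: "i < n * 2" "j < n * 2"
    by auto
  have "(ZR n * ZR n) $$ (i, j) = (\<Sum>k<n * 2. ZR n $$ (i, k) * ZR n $$ (k, j))"
    using ij by (simp add: carrier_matD[OF ZR_carrier] scalar_prod_def lessThan_atLeast0)
  \<comment> \<open>Diagonality leaves only \<open>k = i\<close>, where for \<open>j = i\<close> the
    sign is squared.\<close>
  also have "\<dots> = (\<Sum>k<n * 2. if k = i then 1\<^sub>m (n * 2) $$ (i, j) else 0)"
    by (rule sum.cong) (use ij in \<open>auto simp: index_ZR\<close>)
  finally show "(ZR n * ZR n) $$ (i, j) = 1\<^sub>m (n * 2) $$ (i, j)"
    using ij by simp
qed (simp_all add: carrier_matD[OF ZR_carrier])

lemma ZR_unitary: "unitary_on (n * 2) (ZR n)"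
  by (rule unitary_on_hermitian_involution[OF ZR_hermitian ZR_involution])

lemma ket00_carrier [simp]: "ket00 n \<in> carrier_vec (n * 2)"
  unfolding ket00_def tensor_vec_def ket0_def by simp

lemma ket00_eq_unit_vec: "ket00 n = unit_vec (n * 2) 0"
proof (rule eq_vecI)
  fix i assume "i < dim_vec (unit_vec (n * 2) 0 :: complex vec)"
  then have "i < n * 2"
    by simp
  moreover have "i = 0 \<longleftrightarrow> i div 2 = 0 \<and> i mod 2 = 0"
    by (metis div_mult_mod_eq div_0 mod_0 mult_0 add_0)
  ultimately show "ket00 n $ i = unit_vec (n * 2) 0 $ i"
    unfolding ket00_def tensor_vec_def ket0_def
    by (auto simp: less_mult_imp_div_less unit_vec_def)
qed (simp add: ket00_def tensor_vec_def ket0_def)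

lemma l2_norm_ket00:
  assumes "n > 0"
  shows "l2_norm (ket00 n) = 1"
proof -
  have "(\<Sum>i<n * 2. (cmod (ket00 n $ i))\<^sup>2) = (\<Sum>i<n * 2. if i = 0 then 1 else 0)"
    by (rule sum.cong) (auto simp: ket00_eq_unit_vec unit_vec_def)
  then show ?thesis
    using assms unfolding l2_norm_def by (simp add: carrier_vecD[OF ket00_carrier])
qed

text \<open>Four instances of \<open>sum_outcome_proj\<close>, with (\<open>P\<close>,
  \<open>V\<close>, \<open>Q\<close>, \<open>W\<close>) equal to (\<open>O1\<close>,
  \<open>U2\<close>, \<open>Z\<close>, \<open>U1\<close>), (\<open>O2\<close>, \<open>1\<close>,
  \<open>Z\<close>, \<open>U2 * U1\<close>), (\<open>O2\<close>, \<open>1\<close>, \<open>Z\<close>,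
  \<open>U2 * Z * U1\<close>) and (\<open>- O1\<close>, \<open>Z * U2\<close>, \<open>Z\<close>,
  \<open>U1\<close>). The runs have probabilities 1/4, 1/8, 1/8 and 1/2, and each defect enters with
  a further factor 1/4.\<close>

lemma p_acc_eq:
  assumes "strategy n U1 U2 O1 O2" "n > 0"
  defines "\<phi> \<equiv> U1 *\<^sub>v ket00 n"
  shows "p_acc n U1 U2 O1 O2 = 1
    - (l2_norm (O1 *\<^sub>v (U2 *\<^sub>v \<phi>) - U2 *\<^sub>v (ZR n *\<^sub>v \<phi>)))\<^sup>2 / 16
    - (l2_norm (O2 *\<^sub>v (U2 *\<^sub>v \<phi>) - ZR n *\<^sub>v (U2 *\<^sub>v \<phi>)))\<^sup>2 / 32
    - (l2_norm (O2 *\<^sub>v (U2 *\<^sub>v (ZR n *\<^sub>v \<phi>)) - ZR n *\<^sub>v (U2 *\<^sub>v (ZR n *\<^sub>v \<phi>))))\<^sup>2 / 32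
    - (l2_norm (O1 *\<^sub>v (ZR n *\<^sub>v (U2 *\<^sub>v \<phi>)) + ZR n *\<^sub>v (U2 *\<^sub>v (ZR n *\<^sub>v \<phi>))))\<^sup>2 / 8"
proof -
  define d where "d = n * 2"
  define Z where "Z = ZR n"
  define \<kappa> where "\<kappa> = ket00 n"
  have U1: "unitary_on d U1" and U2: "unitary_on d U2"
    and O1: "hermitian_on d O1" "O1 * O1 = 1\<^sub>m d" and O2: "hermitian_on d O2" "O2 * O2 = 1\<^sub>m d"
    using assms(1) unfolding strategy_def d_def by auto
  have Z: "unitary_on d Z" and Zc: "Z \<in> carrier_mat d d"
    unfolding Z_def d_def using ZR_unitary by auto
  have \<kappa>: "\<kappa> \<in> carrier_vec d" "l2_norm \<kappa> = 1"
    unfolding \<kappa>_def d_def using assms(2) l2_norm_ket00 by auto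
  note U1c = unitary_onD(1)[OF U1] and U2c = unitary_onD(1)[OF U2]
  note O1c = hermitian_onD(1)[OF O1(1)] and O2c = hermitian_onD(1)[OF O2(1)]
  note mat_c = mult_carrier_mat[of _ d d _ d] and vec_c = mult_mat_vec_carrier[of _ d d]
  have one: "unitary_on d (1\<^sub>m d)"
    unfolding unitary_on_def by (auto simp: index_mat_adjoint intro!: eq_matI)
  have \<phi>: "\<phi> \<in> carrier_vec d" "l2_norm \<phi> = 1"
    unfolding \<phi>_def using U1c \<kappa> vec_c l2_norm_unitary[OF U1 \<kappa>(1)] \<kappa>_def by auto
  have U2\<phi>: "U2 *\<^sub>v \<phi> \<in> carrier_vec d" "l2_norm (U2 *\<^sub>v \<phi>) = 1"
    using U2c \<phi> vec_c l2_norm_unitary[OF U2 \<phi>(1)] by auto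
  have Z\<phi>: "Z *\<^sub>v \<phi> \<in> carrier_vec d" "l2_norm (Z *\<^sub>v \<phi>) = 1"
    using Zc \<phi> vec_c l2_norm_unitary[OF Z \<phi>(1)] by auto
  have U2Z\<phi>: "U2 *\<^sub>v (Z *\<^sub>v \<phi>) \<in> carrier_vec d" "l2_norm (U2 *\<^sub>v (Z *\<^sub>v \<phi>)) = 1"
    using U2c Z\<phi> vec_c l2_norm_unitary[OF U2 Z\<phi>(1)] by auto
  have ZU2: "Z * U2 \<in> carrier_mat d d" "unitary_on d (Z * U2)"
    using mat_c Zc U2c unitary_on_mult[OF Z U2] by auto
  have U2U1: "U2 * U1 \<in> carrier_mat d d" "(U2 * U1) *\<^sub>v \<kappa> = U2 *\<^sub>v \<phi>"
    using mat_c U1c U2c assoc_mult_mat_vec[OF U2c U1c \<kappa>(1)] unfolding \<phi>_def \<kappa>_def by auto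
  have U2ZU1: "U2 * Z * U1 \<in> carrier_mat d d" "(U2 * Z * U1) *\<^sub>v \<kappa> = U2 *\<^sub>v (Z *\<^sub>v \<phi>)"
    using mat_c U1c U2c Zc assoc_mult_mat_vec[OF mat_c[OF U2c Zc] U1c \<kappa>(1)]
      assoc_mult_mat_vec[OF U2c Zc \<phi>(1)] unfolding \<phi>_def \<kappa>_def by auto
  have pow: "Z ^\<^sub>m 0 = 1\<^sub>m d" "Z ^\<^sub>m Suc 0 = Z"
    using Zc by auto
  have "p_cons n U1 U2 O1 O2 1 (0, 0) = 1 - (l2_norm (O1 *\<^sub>v (U2 *\<^sub>v \<phi>) - U2 *\<^sub>v (Z *\<^sub>v \<phi>)))\<^sup>2 / 4"
    using sum_outcome_proj[where n = n, folded d_def, OF O1 U2 Z U1c \<kappa>(1)] \<phi>(2) U1c pow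
    unfolding p_cons_def U_upto_def U_from_def \<phi>_def \<kappa>_def Z_def by simp
  moreover have "p_cons n U1 U2 O1 O2 2 (0, 0)
      = 1 - (l2_norm (O2 *\<^sub>v (U2 *\<^sub>v \<phi>) - Z *\<^sub>v (U2 *\<^sub>v \<phi>)))\<^sup>2 / 4"
  proof -
    have "U_upto n U1 U2 2 (0, 0) = U2 * U1" "U_from n U2 2 = 1\<^sub>m d"
      using U1c U2c pow unfolding U_upto_def U_from_def Z_def d_def by auto
    then show ?thesis
      using sum_outcome_proj[where n = n, folded d_def, OF O2 one Z U2U1(1) \<kappa>(1)] U2\<phi> Zc vec_c[OF Zc U2\<phi>(1)]
      unfolding p_cons_def U2U1(2) by (simp add: Z_def \<kappa>_def del: index_mult_mat_vec)
  qed
  moreover have "p_cons n U1 U2 O1 O2 2 (1, 0)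
      = 1 - (l2_norm (O2 *\<^sub>v (U2 *\<^sub>v (Z *\<^sub>v \<phi>)) - Z *\<^sub>v (U2 *\<^sub>v (Z *\<^sub>v \<phi>))))\<^sup>2 / 4"
  proof -
    have "U_upto n U1 U2 2 (1, 0) = U2 * Z * U1" "U_from n U2 2 = 1\<^sub>m d"
      using U1c U2c Zc pow unfolding U_upto_def U_from_def Z_def d_def by auto
    then show ?thesis
      using sum_outcome_proj[where n = n, folded d_def, OF O2 one Z U2ZU1(1) \<kappa>(1)] U2Z\<phi> Zc vec_c[OF Zc U2Z\<phi>(1)]
      unfolding p_cons_def U2ZU1(2) by (simp add: Z_def \<kappa>_def del: index_mult_mat_vec)
  qed
  moreover have "p_anti n U1 U2 O1
      = 1 - (l2_norm (O1 *\<^sub>v (Z *\<^sub>v (U2 *\<^sub>v \<phi>)) + Z *\<^sub>v (U2 *\<^sub>v (Z *\<^sub>v \<phi>))))\<^sup>2 / 4"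
  proof -
    have "(- O1) * (- O1) = 1\<^sub>m d"
      using O1c O1(2) by simp
    note sum_outcome_proj[where n = n, folded d_def, OF hermitian_on_uminus[OF O1(1)] this ZU2(2) Z U1c \<kappa>(1)]
    \<comment> \<open>Outcome \<open>- a\<close> of \<open>O1\<close> is outcome \<open>a\<close> of
      \<open>- O1\<close>. The flip in round 2 is absorbed into the unitary between the two
      measurements.\<close>
    moreover have "outcome_proj n (- a) O1 * Z * U2 = outcome_proj n a (- O1) * (Z * U2)" for a
      unfolding outcome_proj_uminus
      by (rule assoc_mult_mat[of _ d d _ d _ d]) (use O1c Zc U2c outcome_proj_carrier[of "- O1" n a] in \<open>auto simp: d_def\<close>)
    \<comment> \<open>The defect for \<open>- O1\<close> is the stated sum up to a global sign,
      which the norm ignores.\<close>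
    moreover have "(- O1) *\<^sub>v ((Z * U2) *\<^sub>v \<phi>) - (Z * U2) *\<^sub>v (Z *\<^sub>v \<phi>)
        = (-1) \<cdot>\<^sub>v (O1 *\<^sub>v (Z *\<^sub>v (U2 *\<^sub>v \<phi>)) + Z *\<^sub>v (U2 *\<^sub>v (Z *\<^sub>v \<phi>)))" (is "?l = ?r")
    proof -
      have minus_diff: "- p - q = (-1) \<cdot>\<^sub>v (p + q)"
        if "p \<in> carrier_vec d" "q \<in> carrier_vec d" for p q :: "complex vec"
        using that by (intro eq_vecI) auto
      have "?l = - (O1 *\<^sub>v (Z *\<^sub>v (U2 *\<^sub>v \<phi>))) - Z *\<^sub>v (U2 *\<^sub>v (Z *\<^sub>v \<phi>))"
        unfolding assoc_mult_mat_vec[OF Zc U2c \<phi>(1)] assoc_mult_mat_vec[OF Zc U2c Z\<phi>(1)]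
        using O1c Zc by (subst uminus_mult_mat_vec) auto
      also have "\<dots> = ?r"
        by (rule minus_diff[OF vec_c[OF O1c vec_c[OF Zc U2\<phi>(1)]] vec_c[OF Zc U2Z\<phi>(1)]])
      finally show ?thesis .
    qed
    ultimately show ?thesis
      using \<phi>(2) unfolding p_anti_def by (simp add: \<phi>_def \<kappa>_def Z_def l2_norm_smult del: index_mult_mat_vec)
  qed
  ultimately show ?thesis
    unfolding p_acc_def Z_def by (simp add: field_simps del: index_mult_mat_vec)
qed


subsection \<open>Soundness\<close>

lemma ket_bra_carrier:
  "v \<in> carrier_vec m \<Longrightarrow> w \<in> carrier_vec n \<Longrightarrow> ket_bra v w \<in> carrier_mat m n"
  unfolding ket_bra_def by auto

lemma mult_ket_bra:
  assumes "A \<in> carrier_mat l m" "v \<in> carrier_vec m"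
  shows "A * ket_bra v w = ket_bra (A *\<^sub>v v) w"
  using assms unfolding ket_bra_def
  by (intro eq_matI) (auto simp: scalar_prod_def sum_distrib_right mult.assoc)

lemma ket_bra_mult_adjoint:
  assumes "A \<in> carrier_mat l m" "w \<in> carrier_vec m"
  shows "ket_bra v w * mat_adjoint A = ket_bra v (A *\<^sub>v w)"
  using assms unfolding ket_bra_def
  by (intro eq_matI)
    (auto simp: scalar_prod_def sum_distrib_left index_mat_adjoint mult_ac intro!: sum.cong)

lemma trace_ket_bra:
  assumes "v \<in> carrier_vec d" "w \<in> carrier_vec d"
  shows "trace (ket_bra v w) = v \<bullet>c w"
  using assms unfolding trace_def ket_bra_def by (auto simp: scalar_prod_def lessThan_atLeast0)

text \<open>The state is pure, so traces against it become inner products.\<close>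

lemma rho_eq_ket_bra:
  assumes "U1 \<in> carrier_mat (n * 2) (n * 2)" "U2 \<in> carrier_mat (n * 2) (n * 2)"
  shows "rho n U1 U2 = ket_bra (U2 *\<^sub>v (U1 *\<^sub>v ket00 n)) (U2 *\<^sub>v (U1 *\<^sub>v ket00 n))"
proof -
  have U: "U2 * U1 \<in> carrier_mat (n * 2) (n * 2)"
    using assms by (intro mult_carrier_mat)
  have v: "U1 *\<^sub>v ket00 n \<in> carrier_vec (n * 2)"
    using assms by (intro mult_mat_vec_carrier) auto
  show ?thesis
    unfolding rho_def mult_ket_bra[OF U ket00_carrier] ket_bra_mult_adjoint[OF assms(1) ket00_carrier]
      ket_bra_mult_adjoint[OF assms(2) v] assoc_mult_mat_vec[OF assms(2,1) ket00_carrier] ..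
qed

text \<open>With \<open>\<psi> = U2 U1 |00>\<close> the trace is the expectation of
  \<open>M * M\<close> in \<open>\<psi>\<close>; moving one Hermitian factor to the other side of
  the inner product leaves a squared norm.\<close>

lemma trace_square_mult_rho:
  assumes M: "hermitian_on (n * 2) M"
    and U: "U1 \<in> carrier_mat (n * 2) (n * 2)" "U2 \<in> carrier_mat (n * 2) (n * 2)"
  shows "trace (M * M * rho n U1 U2)
    = complex_of_real ((l2_norm (M *\<^sub>v (U2 *\<^sub>v (U1 *\<^sub>v ket00 n))))\<^sup>2)"
proof -
  note Mc = hermitian_onD[OF M]
  define \<psi> where "\<psi> = U2 *\<^sub>v (U1 *\<^sub>v ket00 n)"
  have \<psi>: "\<psi> \<in> carrier_vec (n * 2)"
    unfolding \<psi>_def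
    by (rule mult_mat_vec_carrier[OF U(2) mult_mat_vec_carrier[OF U(1) ket00_carrier]])
  have M\<psi>: "M *\<^sub>v \<psi> \<in> carrier_vec (n * 2)"
    by (rule mult_mat_vec_carrier[OF Mc(1) \<psi>])
  have "M * M * rho n U1 U2 = ket_bra (M *\<^sub>v (M *\<^sub>v \<psi>)) \<psi>"
    unfolding rho_eq_ket_bra[OF U] \<psi>_def[symmetric]
      mult_ket_bra[OF mult_carrier_mat[OF Mc(1) Mc(1)] \<psi>] assoc_mult_mat_vec[OF Mc(1) Mc(1) \<psi>] ..
  then have "trace (M * M * rho n U1 U2) = (M *\<^sub>v (M *\<^sub>v \<psi>)) \<bullet>c \<psi>"
    using trace_ket_bra[OF mult_mat_vec_carrier[OF Mc(1) M\<psi>] \<psi>] by simp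
  also have "\<dots> = (M *\<^sub>v \<psi>) \<bullet>c (M *\<^sub>v \<psi>)"
    unfolding conjugate_scalar_prod_mat_adjoint[OF Mc(1) M\<psi> \<psi>] Mc(2) ..
  finally show ?thesis
    unfolding conjugate_square_eq_l2_norm \<psi>_def .
qed

text \<open>Taking adjoints merely swaps the two summands.\<close>

lemma hermitian_on_anticommutator:
  assumes "hermitian_on d A" "hermitian_on d B"
  shows "hermitian_on d (A * B + B * A)"
proof -
  note A = hermitian_onD[OF assms(1)] and B = hermitian_onD[OF assms(2)]
  have AB: "A * B \<in> carrier_mat d d" "B * A \<in> carrier_mat d d"
    using A B by (auto intro!: mult_carrier_mat)
  show ?thesis
    unfolding hermitian_on_def mat_adjoint_add[OF AB] mat_adjoint_mult[OF A(1) B(1)]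
      mat_adjoint_mult[OF B(1) A(1)] A(2) B(2)
    using AB by (auto simp: comm_add_mat)
qed

text \<open>Idealized, \<open>O1\<close> turns \<open>\<psi>\<close> into \<open>\<chi>\<close>,
  \<open>O2\<close> acts as \<open>Z\<close> on both, and \<open>O1 Z \<psi> = - Z \<chi>\<close>.
  Then \<open>O1 O2 \<psi> = O1 Z \<psi> = - Z \<chi>\<close> while
  \<open>O2 O1 \<psi> = O2 \<chi> = Z \<chi>\<close>, and the two cancel. The vectors
  \<open>e1\<close> to \<open>e4\<close> are the errors of these four equations.\<close>

lemma anticommutator_bound:
  assumes "strategy n U1 U2 O1 O2" "n > 0"
  shows "(l2_norm ((O1 * O2 + O2 * O1) *\<^sub>v (U2 *\<^sub>v (U1 *\<^sub>v ket00 n))))\<^sup>2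
    \<le> 128 * (1 - p_acc n U1 U2 O1 O2)"
proof -
  define d where "d = n * 2"
  define Z where "Z = ZR n"
  define \<phi> where "\<phi> = U1 *\<^sub>v ket00 n"
  define \<psi> where "\<psi> = U2 *\<^sub>v \<phi>"
  define \<chi> where "\<chi> = U2 *\<^sub>v (Z *\<^sub>v \<phi>)"
  have U1: "unitary_on d U1" and U2: "unitary_on d U2"
    and O1: "hermitian_on d O1" "O1 * O1 = 1\<^sub>m d" and O2: "hermitian_on d O2" "O2 * O2 = 1\<^sub>m d"
    using assms(1) unfolding strategy_def d_def by auto
  note U1c = unitary_onD(1)[OF U1] and U2c = unitary_onD(1)[OF U2]
  note O1c = hermitian_onD(1)[OF O1(1)] and O2c = hermitian_onD(1)[OF O2(1)]
  note O1u = unitary_on_hermitian_involution[OF O1] and O2u = unitary_on_hermitian_involution[OF O2]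
  have Zc: "Z \<in> carrier_mat d d" and \<kappa>: "ket00 n \<in> carrier_vec d"
    unfolding Z_def d_def by auto
  note vec_c = mult_mat_vec_carrier[of _ d d]
  have \<phi>: "\<phi> \<in> carrier_vec d"
    unfolding \<phi>_def by (rule vec_c[OF U1c \<kappa>])
  have \<psi>: "\<psi> \<in> carrier_vec d" and \<chi>: "\<chi> \<in> carrier_vec d"
    unfolding \<psi>_def \<chi>_def using U2c Zc \<phi> vec_c by blast+
  have Z\<psi>: "Z *\<^sub>v \<psi> \<in> carrier_vec d" and Z\<chi>: "Z *\<^sub>v \<chi> \<in> carrier_vec d"
    using Zc \<psi> \<chi> vec_c by blast+
  define e1 where "e1 = O1 *\<^sub>v \<psi> - \<chi>"
  define e2 where "e2 = O2 *\<^sub>v \<psi> - Z *\<^sub>v \<psi>"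
  define e3 where "e3 = O2 *\<^sub>v \<chi> - Z *\<^sub>v \<chi>"
  define e4 where "e4 = O1 *\<^sub>v (Z *\<^sub>v \<psi>) + Z *\<^sub>v \<chi>"
  have O\<psi>: "O1 *\<^sub>v \<psi> \<in> carrier_vec d" "O2 *\<^sub>v \<psi> \<in> carrier_vec d" "O2 *\<^sub>v \<chi> \<in> carrier_vec d"
    "O1 *\<^sub>v (Z *\<^sub>v \<psi>) \<in> carrier_vec d"
    using O1c O2c \<psi> \<chi> Z\<psi> vec_c by blast+
  have OO\<psi>: "O1 *\<^sub>v (O2 *\<^sub>v \<psi>) \<in> carrier_vec d" "O2 *\<^sub>v (O1 *\<^sub>v \<psi>) \<in> carrier_vec d"
    using O1c O2c O\<psi> vec_c by blast+
  have e: "e1 \<in> carrier_vec d" "e2 \<in> carrier_vec d" "e3 \<in> carrier_vec d" "e4 \<in> carrier_vec d"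
    unfolding e1_def e2_def e3_def e4_def using \<chi> Z\<psi> Z\<chi> O\<psi> by auto
  have Oe: "O1 *\<^sub>v e2 \<in> carrier_vec d" "O2 *\<^sub>v e1 \<in> carrier_vec d"
    using O1c O2c e vec_c by blast+
  have "(O1 * O2 + O2 * O1) *\<^sub>v \<psi> = (O1 * O2) *\<^sub>v \<psi> + (O2 * O1) *\<^sub>v \<psi>"
    by (rule add_mult_distrib_mat_vec[OF mult_carrier_mat[OF O1c O2c] mult_carrier_mat[OF O2c O1c] \<psi>])
  also have "\<dots> = O1 *\<^sub>v (O2 *\<^sub>v \<psi>) + O2 *\<^sub>v (O1 *\<^sub>v \<psi>)"
    unfolding assoc_mult_mat_vec[OF O1c O2c \<psi>] assoc_mult_mat_vec[OF O2c O1c \<psi>] ..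
  also have "\<dots> = (O1 *\<^sub>v e2 + e4) + (O2 *\<^sub>v e1 + e3)"
  proof -
    \<comment> \<open>The telescoping runs through \<open>r = O1 Z \<psi>\<close>,
      \<open>s = Z \<chi>\<close> and \<open>t = O2 \<chi>\<close>; its brackets are
      \<open>O1 e2\<close>, \<open>e4\<close>, \<open>O2 e1\<close> and \<open>e3\<close>.\<close>
    have cancel: "p + q = ((p - r) + (r + s)) + ((q - t) + (t - s))"
      if "p \<in> carrier_vec d" "q \<in> carrier_vec d" "r \<in> carrier_vec d" "s \<in> carrier_vec d"
        "t \<in> carrier_vec d" for p q r s t :: "complex vec"
      using that by (intro eq_vecI) auto
    show ?thesis
      unfolding e1_def e2_def e3_def e4_def mult_minus_distrib_mat_vec[OF O1c O\<psi>(2) Z\<psi>]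
        mult_minus_distrib_mat_vec[OF O2c O\<psi>(1) \<chi>]
      by (rule cancel[OF OO\<psi> O\<psi>(4) Z\<chi> O\<psi>(3)])
  qed
  finally have "(l2_norm ((O1 * O2 + O2 * O1) *\<^sub>v \<psi>))\<^sup>2
      \<le> 4 * ((l2_norm e2)\<^sup>2 + (l2_norm e4)\<^sup>2 + (l2_norm e1)\<^sup>2 + (l2_norm e3)\<^sup>2)"
    using l2_norm_add4_le[OF Oe(1) e(4) Oe(2) e(3)] l2_norm_unitary[OF O1u e(2)]
      l2_norm_unitary[OF O2u e(1)] by simp
  moreover have "p_acc n U1 U2 O1 O2 = 1 - (l2_norm e1)\<^sup>2 / 16 - (l2_norm e2)\<^sup>2 / 32
      - (l2_norm e3)\<^sup>2 / 32 - (l2_norm e4)\<^sup>2 / 8"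
    unfolding p_acc_eq[OF assms] e1_def e2_def e3_def e4_def \<psi>_def \<chi>_def \<phi>_def Z_def ..
  \<comment> \<open>The smallest weights in \<open>p_acc\<close> are the 1/32 of \<open>e2\<close>
    and \<open>e3\<close>, so the constant is 4 * 32 = 128. The surplus in \<open>e1\<close> and
    \<open>e4\<close> is discarded as nonnegative.\<close>
  moreover have "(l2_norm e1)\<^sup>2 \<ge> 0" "(l2_norm e4)\<^sup>2 \<ge> 0"
    by simp_all
  ultimately show ?thesis
    unfolding \<psi>_def \<phi>_def by argo
qed

section \<open>Inverses and conjugates of involutions\<close>

text \<open>Being its own inverse, \<open>A\<close> is a unit of the matrix ring, which rules out
  the result \<open>None\<close>; any inverse that is returned equals \<open>A\<close> by
  uniqueness.\<close>

lemma inv_mat_involution: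
  assumes A: "A \<in> carrier_mat d d" and AA: "A * A = 1\<^sub>m d"
  shows "inv_mat A = A"
proof (cases "mat_inverse A")
  case None
  have "A \<in> Units (ring_mat TYPE(complex) d ())"
    using A AA unfolding Units_def ring_mat_def by auto
  then show ?thesis
    using mat_inverse(1)[OF A None, of "()"] by blast
next
  case (Some B)
  have B: "A * B = 1\<^sub>m d" "B \<in> carrier_mat d d"
    using mat_inverse(2)[OF A Some] by auto
  have "B = A * A * B"
    using AA B by simp
  also have "\<dots> = A"
    using assoc_mult_mat[OF A A B(2)] B A by simp
  finally show ?thesis
    using Some unfolding inv_mat_def by simp
qed

text \<open>Makes the honest observables admissible: \<open>R2\<close> is its own inverse, so
  conjugation by it has the form \<open>R * T * R\<close>, whose square cancels from the middle
  outwards.\<close>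

lemma hermitian_involution_conj:
  assumes R: "hermitian_on d R" "R * R = 1\<^sub>m d" and T: "hermitian_on d T" "T * T = 1\<^sub>m d"
  shows "hermitian_on d (R * T * R)" "R * T * R * (R * T * R) = 1\<^sub>m d"
proof -
  note Rc = hermitian_onD[OF R(1)] and Tc = hermitian_onD[OF T(1)]
  note mult_c = mult_carrier_mat[of _ d d _ d]
  have RT: "R * T \<in> carrier_mat d d" and TR: "T * R \<in> carrier_mat d d"
    using Rc Tc mult_c by blast+
  show "hermitian_on d (R * T * R)"
    unfolding hermitian_on_def mat_adjoint_mult[OF RT Rc(1)] mat_adjoint_mult[OF Rc(1) Tc(1)] Rc(2) Tc(2)
    using mult_c[OF RT Rc(1)] assoc_mult_mat[OF Rc(1) Tc(1) Rc(1)] by simp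
  have "R * (R * T * R) = T * R"
    using assoc_mult_mat[OF Rc(1) Tc(1) Rc(1)] assoc_mult_mat[OF Rc(1) Rc(1) TR] R(2)
      left_mult_one_mat[OF TR] by simp
  moreover have "T * (T * R) = R"
    using assoc_mult_mat[OF Tc(1) Tc(1) Rc(1)] T(2) Rc by simp
  ultimately have "R * T * (R * (R * T * R)) = R * R"
    using assoc_mult_mat[OF Rc(1) Tc(1) TR] by simp
  then show "R * T * R * (R * T * R) = 1\<^sub>m d"
    using assoc_mult_mat[OF RT Rc(1) mult_c[OF RT Rc(1)]] R(2) by simp
qed


subsection \<open>Completeness\<close>

text \<open>The index ranges are explicit sets so that simplification splits the goal into 16 entry
  equations.\<close>

lemma eq_mat_4I:
  assumes "A \<in> carrier_mat 4 4" "B \<in> carrier_mat 4 4"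
    "\<forall>i\<in>{0, 1, 2, 3}. \<forall>j\<in>{0, 1, 2, 3}. A $$ (i, j) = B $$ (i, j)"
  shows "A = B"
proof (rule eq_matI)
  fix i j assume "i < dim_row B" "j < dim_col B"
  then have "i \<in> {0, 1, 2, 3}" "j \<in> {0, 1, 2, 3}"
    using assms(2) by auto
  then show "A $$ (i, j) = B $$ (i, j)"
    using assms(3) by blast
qed (use assms in auto)

lemma eq_vec_4I:
  assumes "v \<in> carrier_vec 4" "w \<in> carrier_vec 4" "\<forall>i\<in>{0, 1, 2, 3}. v $ i = w $ i"
  shows "v = w"
proof (rule eq_vecI)
  fix i assume "i < dim_vec w"
  then have "i \<in> {0, 1, 2, 3}"
    using assms(2) by auto
  then show "v $ i = w $ i"
    using assms(3) by blast
qed (use assms in auto)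

text \<open>The dimension is fixed at 4 rather than read off the list, so carrier conditions hold
  for every argument and entries of products unfold to four-term sums of list lookups.\<close>

definition mat4 :: "complex list list \<Rightarrow> complex mat" where
  "mat4 rs = mat 4 4 (\<lambda>(i, j). rs ! i ! j)"

lemma mat4_carrier [simp]: "mat4 rs \<in> carrier_mat 4 4"
  unfolding mat4_def by simp

lemma index_mat4: "i < 4 \<Longrightarrow> j < 4 \<Longrightarrow> mat4 rs $$ (i, j) = rs ! i ! j"
  unfolding mat4_def by simp

lemma index_mat4_mult:
  assumes "i < 4" "j < 4"
  shows "(mat4 rs * mat4 ss) $$ (i, j)
    = rs ! i ! 0 * ss ! 0 ! j + rs ! i ! 1 * ss ! 1 ! j + rs ! i ! 2 * ss ! 2 ! j + rs ! i ! 3 * ss ! 3 ! j"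
  using assms by (simp add: mat4_def scalar_prod_def eval_nat_numeral)

lemma index_mat4_mult_vec:
  assumes "i < 4" "v \<in> carrier_vec 4"
  shows "(mat4 rs *\<^sub>v v) $ i
    = rs ! i ! 0 * v $ 0 + rs ! i ! 1 * v $ 1 + rs ! i ! 2 * v $ 2 + rs ! i ! 3 * v $ 3"
  using assms by (simp add: mat4_def scalar_prod_def eval_nat_numeral)

lemma index_tensor_mat:
  assumes "A \<in> carrier_mat 2 2" "B \<in> carrier_mat 2 2" "i < 4" "j < 4"
  shows "tensor_mat A B $$ (i, j) = A $$ (i div 2, j div 2) * B $$ (i mod 2, j mod 2)"
  using assms unfolding tensor_mat_def by simp

lemma tensor_mat_carrier:
  assumes "A \<in> carrier_mat 2 2" "B \<in> carrier_mat 2 2"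
  shows "tensor_mat A B \<in> carrier_mat 4 4"
  using assms unfolding tensor_mat_def by simp

lemma pauli_X_carrier [simp]: "pauli_X \<in> carrier_mat 2 2"
  unfolding pauli_X_def mat_of_rows_list_def by (rule carrier_matI) auto

lemma index_pauli_X: "i < 2 \<Longrightarrow> j < 2 \<Longrightarrow> pauli_X $$ (i, j) = (if i = j then 0 else 1)"
  unfolding pauli_X_def mat_of_rows_list_def by (auto simp: less_2_cases_iff)

lemma pauli_Z_carrier [simp]: "pauli_Z \<in> carrier_mat 2 2"
  by (rule carrier_matI) auto

lemma ket_carrier [simp]:
  "ket0 \<in> carrier_vec 2" "ket1 \<in> carrier_vec 2" "ket_plus \<in> carrier_vec 2" "ket_minus \<in> carrier_vec 2"
  unfolding ket0_def ket1_def ket_plus_def ket_minus_def by auto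

lemma index_ket_bra:
  assumes "i < 2" "j < 2"
  shows "ket_bra ket0 ket0 $$ (i, j) = (if i = 0 \<and> j = 0 then 1 else 0)"
    "ket_bra ket1 ket1 $$ (i, j) = (if i = 1 \<and> j = 1 then 1 else 0)"
    "ket_bra ket_plus ket_plus $$ (i, j) = 1/2"
    "ket_bra ket_minus ket_minus $$ (i, j) = (if i = j then 1/2 else -1/2)"
proof -
  have half: "complex_of_real (sqrt 2) * complex_of_real (sqrt 2) = 2"
    unfolding of_real_mult[symmetric] by simp
  have ij: "i = 0 \<or> i = 1" "j = 0 \<or> j = 1"
    using assms by auto
  show "ket_bra ket0 ket0 $$ (i, j) = (if i = 0 \<and> j = 0 then 1 else 0)"
    "ket_bra ket1 ket1 $$ (i, j) = (if i = 1 \<and> j = 1 then 1 else 0)"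
    using ij by (auto simp: ket_bra_def ket0_def ket1_def unit_vec_def)
  show "ket_bra ket_plus ket_plus $$ (i, j) = 1/2"
    "ket_bra ket_minus ket_minus $$ (i, j) = (if i = j then 1/2 else -1/2)"
    using ij half
    by (auto simp: ket_bra_def ket_plus_def ket_minus_def ket0_def ket1_def unit_vec_def)
qed

section \<open>The honest operators as explicit matrices\<close>

lemma R1_eq: "R1 = mat4 [[1, 0, 0, 0], [0, 1, 0, 0], [0, 0, 0, 1], [0, 0, 1, 0]]"
  unfolding R1_def
  by (rule eq_mat_4I)
    (simp_all add: tensor_mat_carrier ket_bra_carrier index_tensor_mat index_ket_bra index_pauli_X
      index_mat4 carrier_matD[OF tensor_mat_carrier])

text \<open>In 2 by 2 blocks over \<open>P\<close>, the diagonal blocks are \<open>(I + X)/2\<close>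
  and the off-diagonal ones \<open>(I - X)/2\<close>.\<close>

lemma R2_eq: "R2 = mat4 [[1/2, 1/2, 1/2, -1/2], [1/2, 1/2, -1/2, 1/2],
    [1/2, -1/2, 1/2, 1/2], [-1/2, 1/2, 1/2, 1/2]]"
  unfolding R2_def
  by (rule eq_mat_4I)
    (simp_all add: tensor_mat_carrier ket_bra_carrier index_tensor_mat index_ket_bra index_pauli_X
      index_mat4 carrier_matD[OF tensor_mat_carrier])

lemma ZP_eq: "tensor_mat pauli_Z (1\<^sub>m 2)
    = mat4 [[1, 0, 0, 0], [0, 1, 0, 0], [0, 0, -1, 0], [0, 0, 0, -1]]"
  by (rule eq_mat_4I)
    (simp_all add: tensor_mat_carrier index_tensor_mat index_pauli_Z index_mat4)

lemma XP_eq: "tensor_mat pauli_X (1\<^sub>m 2)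
    = mat4 [[0, 0, 1, 0], [0, 0, 0, 1], [1, 0, 0, 0], [0, 1, 0, 0]]"
  by (rule eq_mat_4I)
    (simp_all add: tensor_mat_carrier index_tensor_mat index_pauli_X index_mat4)

lemma ZR_2_eq: "ZR 2 = mat4 [[1, 0, 0, 0], [0, -1, 0, 0], [0, 0, 1, 0], [0, 0, 0, -1]]"
  unfolding ZR_def
  by (rule eq_mat_4I)
    (simp_all add: tensor_mat_carrier index_tensor_mat index_pauli_Z index_mat4)

lemmas mat4_eqs = R1_eq R2_eq ZP_eq XP_eq ZR_2_eq

lemma honest_hermitian:
  "hermitian_on 4 R1" "hermitian_on 4 R2"
  "hermitian_on 4 (tensor_mat pauli_Z (1\<^sub>m 2))" "hermitian_on 4 (tensor_mat pauli_X (1\<^sub>m 2))"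
  unfolding hermitian_on_def mat4_eqs
  by (intro conjI mat4_carrier eq_mat_4I mat_adjoint_carrier;
      simp add: index_mat_adjoint index_mat4 carrier_matD[OF mat4_carrier])+

lemma honest_involution:
  "R1 * R1 = 1\<^sub>m 4" "R2 * R2 = 1\<^sub>m 4"
  "tensor_mat pauli_Z (1\<^sub>m 2) * tensor_mat pauli_Z (1\<^sub>m 2) = 1\<^sub>m 4"
  "tensor_mat pauli_X (1\<^sub>m 2) * tensor_mat pauli_X (1\<^sub>m 2) = 1\<^sub>m 4"
  unfolding mat4_eqs
  by (rule eq_mat_4I; simp add: mult_carrier_mat[of _ 4 4] index_mat4_mult del: index_mult_mat)+

text \<open>All the facts about the honest states that completeness uses. Indices 0 and 2 are
  \<open>|00>\<close> and \<open>|10>\<close>. The last equation says that, on \<open>|00>\<close>,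
  \<open>Z\<close> on \<open>R\<close> after \<open>R2\<close> equals \<open>X\<close> on
  \<open>P\<close> before \<open>R2\<close>.\<close>

lemma honest_action:
  "R1 *\<^sub>v unit_vec 4 0 = unit_vec 4 0"
  "ZR 2 *\<^sub>v unit_vec 4 0 = unit_vec 4 0"
  "tensor_mat pauli_Z (1\<^sub>m 2) *\<^sub>v unit_vec 4 0 = unit_vec 4 0"
  "tensor_mat pauli_X (1\<^sub>m 2) *\<^sub>v unit_vec 4 0 = unit_vec 4 2"
  "tensor_mat pauli_Z (1\<^sub>m 2) *\<^sub>v unit_vec 4 2 = (-1) \<cdot>\<^sub>v unit_vec 4 2"
  "ZR 2 *\<^sub>v (R2 *\<^sub>v unit_vec 4 0) = R2 *\<^sub>v unit_vec 4 2"
  unfolding mat4_eqs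
  by (rule eq_vec_4I;
      simp add: mult_mat_vec_carrier[of _ 4 4] index_mat4_mult_vec unit_vec_def del: index_mult_mat_vec)+


text \<open>Since \<open>R1\<close> and \<open>Z\<close> fix \<open>|00>\<close>, the states
  \<open>\<psi>\<close> and \<open>\<chi>\<close> of the soundness argument both equal
  \<open>R2 |00>\<close>. There \<open>O1\<close> acts trivially, \<open>O2\<close> and
  \<open>Z\<close> both give \<open>R2 |10>\<close>, and \<open>O1\<close> negates that vector, so
  every defect is zero.\<close>

lemma p_acc_honest:
  "p_acc 2 R1 (R2 * inv_mat R1) (R2 * tensor_mat pauli_Z (1\<^sub>m 2) * inv_mat R2)
    (R2 * tensor_mat pauli_X (1\<^sub>m 2) * inv_mat R2) = 1"
proof -
  define ZP where "ZP = tensor_mat pauli_Z (1\<^sub>m 2)"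
  define XP where "XP = tensor_mat pauli_X (1\<^sub>m 2)"
  define e where "e i = (unit_vec 4 i :: complex vec)" for i
  note herm = honest_hermitian[folded ZP_def XP_def]
  note inv = honest_involution[folded ZP_def XP_def]
  note action = honest_action[folded ZP_def XP_def e_def]
  note carrier = herm[THEN hermitian_onD(1)]
  have e: "e i \<in> carrier_vec 4" for i
    unfolding e_def by simp
  have R2e: "R2 *\<^sub>v e i \<in> carrier_vec 4" for i
    by (rule mult_mat_vec_carrier[OF carrier(2) e])
  have inv_R: "inv_mat R1 = R1" "inv_mat R2 = R2"
    using inv_mat_involution carrier inv by blast+
  have strategy: "strategy 2 R1 (R2 * R1) (R2 * ZP * R2) (R2 * XP * R2)"
    unfolding strategy_def
    using unitary_on_hermitian_involution[OF herm(1) inv(1)]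
      unitary_on_mult[OF unitary_on_hermitian_involution[OF herm(2) inv(2)]
        unitary_on_hermitian_involution[OF herm(1) inv(1)]]
      hermitian_involution_conj[OF herm(2) inv(2) herm(3) inv(3)]
      hermitian_involution_conj[OF herm(2) inv(2) herm(4) inv(4)]
    by simp
  have ket: "ket00 2 = e 0"
    unfolding ket00_eq_unit_vec e_def by simp
  have U2: "(R2 * R1) *\<^sub>v e 0 = R2 *\<^sub>v e 0"
    unfolding assoc_mult_mat_vec[OF carrier(2) carrier(1) e] action ..
  \<comment> \<open>Reduces the honest observables on states \<open>R2 e i\<close> to Pauli
    operators on basis vectors.\<close>
  have conj: "(R2 * T * R2) *\<^sub>v (R2 *\<^sub>v e i) = R2 *\<^sub>v (T *\<^sub>v e i)" if "T \<in> carrier_mat 4 4" for T i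
    unfolding assoc_mult_mat_vec[OF mult_carrier_mat[OF carrier(2) that] carrier(2) R2e]
      assoc_mult_mat_vec[OF carrier(2) carrier(2) e, symmetric] inv(2)
    using assoc_mult_mat_vec[OF carrier(2) that e] e by simp
  have neg: "R2 *\<^sub>v ((-1) \<cdot>\<^sub>v e 2) = (-1) \<cdot>\<^sub>v (R2 *\<^sub>v e 2)"
    by (rule mult_mat_vec[OF carrier(2) e])
  have "v - v = 0\<^sub>v 4" "(-1) \<cdot>\<^sub>v v + v = 0\<^sub>v 4" if "v \<in> carrier_vec 4" for v :: "complex vec"
    using that by auto
  note this[OF R2e]
  moreover have "l2_norm (0\<^sub>v 4) = 0"
    unfolding l2_norm_def by simp
  ultimately show ?thesis
    using p_acc_eq[OF strategy] unfolding inv_R ZP_def[symmetric] XP_def[symmetric]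
    by (simp add: ket action U2 conj carrier neg del: index_mult_mat_vec)
qed

theorem theoremA12:
  shows
    "(\<forall>U1 U2 O1 O2.
        U1 = R1 \<and> U2 = R2 * inv_mat R1 \<and>
        O1 = R2 * tensor_mat pauli_Z (1\<^sub>m 2) * inv_mat R2 \<and>
        O2 = R2 * tensor_mat pauli_X (1\<^sub>m 2) * inv_mat R2
        \<longrightarrow> p_acc 2 U1 U2 O1 O2 = 1)
     \<and>
     (\<exists>C::real. \<forall>\<delta>>0. \<forall>n>0. \<forall>U1 U2 O1 O2.
        strategy n U1 U2 O1 O2 \<and> p_acc n U1 U2 O1 O2 > 1 - \<delta>
        \<longrightarrow> trace ((O1 * O2 + O2 * O1) * (O1 * O2 + O2 * O1) * rho n U1 U2)
              \<le> complex_of_real (C * \<delta>))"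
proof (intro conjI exI[of _ 128] allI impI)
  fix U1 U2 O1 O2
  assume "U1 = R1 \<and> U2 = R2 * inv_mat R1 \<and>
    O1 = R2 * tensor_mat pauli_Z (1\<^sub>m 2) * inv_mat R2 \<and>
    O2 = R2 * tensor_mat pauli_X (1\<^sub>m 2) * inv_mat R2"
  then show "p_acc 2 U1 U2 O1 O2 = 1"
    using p_acc_honest by simp
next
  fix \<delta> :: real and n U1 U2 O1 O2
  assume "n > 0" and "strategy n U1 U2 O1 O2 \<and> p_acc n U1 U2 O1 O2 > 1 - \<delta>"
  then have strat: "strategy n U1 U2 O1 O2" and acc: "p_acc n U1 U2 O1 O2 > 1 - \<delta>"
    by auto
  have "(l2_norm ((O1 * O2 + O2 * O1) *\<^sub>v (U2 *\<^sub>v (U1 *\<^sub>v ket00 n))))\<^sup>2 \<le> 128 * \<delta>"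
    using anticommutator_bound[OF strat \<open>n > 0\<close>] acc by argo
  moreover have "trace ((O1 * O2 + O2 * O1) * (O1 * O2 + O2 * O1) * rho n U1 U2)
      = complex_of_real ((l2_norm ((O1 * O2 + O2 * O1) *\<^sub>v (U2 *\<^sub>v (U1 *\<^sub>v ket00 n))))\<^sup>2)"
    using strat unfolding strategy_def unitary_on_def
    by (intro trace_square_mult_rho hermitian_on_anticommutator) auto
  \<comment> \<open>The order on complex numbers also demands equal imaginary parts, which is why
    the trace is first identified as a real number.\<close>
  ultimately show "trace ((O1 * O2 + O2 * O1) * (O1 * O2 + O2 * O1) * rho n U1 U2)
      \<le> complex_of_real (128 * \<delta>)"
    by (simp only: less_eq_complex_def Re_complex_of_real Im_complex_of_real)
qed

end
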